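(* Let $f=\mathsf{F}^{\geq 0.5}a$ (i.e. the PCTL formula $\top\,\mathsf{U}^{\geq 0.5}a$) for an atomic proposition $a$. Then there is no closed PμTL formula $g$ such that $[\![g]\!]_M=[\![f]\!]_M$ for every Markov chain $M$.
   Context: Fix a countable set $\mathcal{A}$ of atomic propositions and a countable set $\mathcal{Z}$ of variables. A Markov chain is $M=(S,\mathbf{T},L)$ with $S$ finite, $\mathbf{T}:S\times S\to[0,1]$ row-stochastic, $L:S\to2^{\mathcal{A}}$. A path is an infinite sequence $s_0s_1\dots$ with $\mathbf{T}(s_i,s_{i+1})>0$; from a state $s$ there is the standard probability measure $\Pr_{M,s}$ on paths starting in $s$, with $\Pr_{M,s}(\text{paths with prefix }s_0\dots s_n)=\prod_{i<n}\mathbf{T}(s_i,s_{i+1})$ if $s_0=s$. PμTL formulas: $f::=\top\mid\bot\mid a\mid\neg a\mid Z\mid \mathsf{X}^{\sim p}f\mid f\wedge f\mid f\vee f\mid \mu Z.f\mid \nu Z.f$ (${\sim}\in\{>,\geq\}$, $p\in[0,1]$), with semantics under an assignment $e:\mathcal{Z}\to2^S$: $[\![\top]\!]=S$, $[\![\bot]\!]=\emptyset$, $[\![a]\!]=\{s:a\in L(s)\}$, $[\![\neg a]\!]=\{s:a\notin L(s)\}$, $[\![Z]\!]=e(Z)$, $[\![\mathsf{X}^{\sim p}f]\!]=\{s:\sum_{s'\in[\![f]\!]}\mathbf{T}(s,s')\sim p\}$, $\wedge,\vee$ as $\cap,\cup$, $\mu Z.f$ the least and $\nu Z.f$ the greatest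 fixpoint of $S'\mapsto[\![f]\!]_M(e[Z\mapsto S'])$. A formula is closed if all variables are bound; then write $[\![f]\!]_M$. PCTL: $\top\,\mathsf{U}^{\geq 0.5}a$ holds at $s$ (i.e. $s\in[\![\mathsf{F}^{\geq0.5}a]\!]_M$) iff $\Pr_{M,s}\{\pi=s_0s_1\dots : \exists i,\ a\in L(s_i)\}\geq 0.5$. *)

theory Defs
  imports "HOL-Probability.Probability"
begin

section \<open>Markov chains and the measure on their paths\<close>

text \<open>The state space is a carrier set, so that all finite chains (up to isomorphism) can be quantified
  over at the single state type \<^typ>\<open>nat\<close>. Values of \<open>trans\<close> and \<open>label\<close> outside the carrier are
  irrelevant.\<close>

record ('s, 'a) mc =
  states :: "'s set"
  trans :: "'s \<Rightarrow> 's \<Rightarrow> real"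
  label :: "'s \<Rightarrow> 'a set"

definition markov_chain :: "('s, 'a) mc \<Rightarrow> bool" where
  "markov_chain M \<longleftrightarrow>
     finite (states M) \<and>
     (\<forall>s\<in>states M. \<forall>t\<in>states M. 0 \<le> trans M s t \<and> trans M s t \<le> 1) \<and>
     (\<forall>s\<in>states M. (\<Sum>t\<in>states M. trans M s t) = 1)"

definition paths :: "('s, 'a) mc \<Rightarrow> 's \<Rightarrow> (nat \<Rightarrow> 's) set" where
  "paths M s = {\<pi>. \<pi> 0 = s \<and> (\<forall>i. \<pi> i \<in> states M \<and> trans M (\<pi> i) (\<pi> (Suc i)) > 0)}"

text \<open>The paths from \<open>s\<close> with prefix \<open>w 0, \<dots>, w n\<close>; the values of \<open>w\<close> beyond \<open>n\<close> are irrelevant.\<close>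

definition cylinder :: "('s, 'a) mc \<Rightarrow> 's \<Rightarrow> (nat \<Rightarrow> 's) \<Rightarrow> nat \<Rightarrow> (nat \<Rightarrow> 's) set" where
  "cylinder M s w n = {\<pi> \<in> paths M s. \<forall>i\<le>n. \<pi> i = w i}"

definition is_path_measure :: "('s, 'a) mc \<Rightarrow> 's \<Rightarrow> (nat \<Rightarrow> 's) measure \<Rightarrow> bool" where
  "is_path_measure M s P \<longleftrightarrow>
     prob_space P \<and> space P = paths M s \<and>
     sets P = sigma_sets (paths M s) {cylinder M s w n |w n. True} \<and>
     (\<forall>w n. w 0 = s \<and> (\<forall>i\<le>n. w i \<in> states M) \<longrightarrow>
        measure P (cylinder M s w n) = (\<Prod>i<n. trans M (w i) (w (Suc i))))"

text \<open>Existence and uniqueness are proved in \<open>ex1_path_measure\<close> below.\<close>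

definition path_measure :: "('s, 'a) mc \<Rightarrow> 's \<Rightarrow> (nat \<Rightarrow> 's) measure" where
  "path_measure M s = (THE P. is_path_measure M s P)"

text \<open>\<open>sat_F_ge M p a\<close> is the set of states satisfying the PCTL formula
  \<open>\<top> U\<^sup>\<ge>\<^sup>p a\<close>.\<close>

definition sat_F_ge :: "('s, 'a) mc \<Rightarrow> real \<Rightarrow> 'a \<Rightarrow> 's set" where
  "sat_F_ge M p a =
     {s \<in> states M. measure (path_measure M s) {\<pi> \<in> paths M s. \<exists>i. a \<in> label M (\<pi> i)} \<ge> p}"


section \<open>The probabilistic mu-calculus\<close>

datatype cmp = Greater | GreaterEq

fun cmp_holds :: "cmp \<Rightarrow> real \<Rightarrow> real \<Rightarrow> bool" where
  "cmp_holds Greater x p \<longleftrightarrow> x > p"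
| "cmp_holds GreaterEq x p \<longleftrightarrow> x \<ge> p"

datatype ('a, 'z) pmutl =
    Top
  | Bot
  | Atom 'a
  | NegAtom 'a
  | Var 'z
  | Next cmp real "('a, 'z) pmutl"
  | And "('a, 'z) pmutl" "('a, 'z) pmutl"
  | Or "('a, 'z) pmutl" "('a, 'z) pmutl"
  | Mu 'z "('a, 'z) pmutl"
  | Nu 'z "('a, 'z) pmutl"

primrec wf_pmutl :: "('a, 'z) pmutl \<Rightarrow> bool" where
  "wf_pmutl Top \<longleftrightarrow> True"
| "wf_pmutl Bot \<longleftrightarrow> True"
| "wf_pmutl (Atom a) \<longleftrightarrow> True"
| "wf_pmutl (NegAtom a) \<longleftrightarrow> True"
| "wf_pmutl (Var Z) \<longleftrightarrow> True"
| "wf_pmutl (Next c p f) \<longleftrightarrow> 0 \<le> p \<and> p \<le> 1 \<and> wf_pmutl f"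
| "wf_pmutl (And f g) \<longleftrightarrow> wf_pmutl f \<and> wf_pmutl g"
| "wf_pmutl (Or f g) \<longleftrightarrow> wf_pmutl f \<and> wf_pmutl g"
| "wf_pmutl (Mu Z f) \<longleftrightarrow> wf_pmutl f"
| "wf_pmutl (Nu Z f) \<longleftrightarrow> wf_pmutl f"

primrec free_vars :: "('a, 'z) pmutl \<Rightarrow> 'z set" where
  "free_vars Top = {}"
| "free_vars Bot = {}"
| "free_vars (Atom a) = {}"
| "free_vars (NegAtom a) = {}"
| "free_vars (Var Z) = {Z}"
| "free_vars (Next c p f) = free_vars f"
| "free_vars (And f g) = free_vars f \<union> free_vars g"
| "free_vars (Or f g) = free_vars f \<union> free_vars g"
| "free_vars (Mu Z f) = free_vars f - {Z}"
| "free_vars (Nu Z f) = free_vars f - {Z}"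

definition closed_pmutl :: "('a, 'z) pmutl \<Rightarrow> bool" where
  "closed_pmutl f \<longleftrightarrow> free_vars f = {}"

text \<open>Assignments are meant to take values in subsets of \<open>states M\<close>. The fixpoints have to be taken in
  the lattice of subsets of \<open>states M\<close>, whereas \<open>lfp\<close> and \<open>gfp\<close> range over all sets of the
  state type; intersecting the argument with \<open>states M\<close> makes the two agree
  (\<open>sem_Mu_least\<close>, \<open>sem_Nu_greatest\<close> below).\<close>

primrec sem :: "('s, 'a) mc \<Rightarrow> ('a, 'z) pmutl \<Rightarrow> ('z \<Rightarrow> 's set) \<Rightarrow> 's set" where
  "sem M Top e = states M"
| "sem M Bot e = {}"
| "sem M (Atom a) e = {s \<in> states M. a \<in> label M s}"
| "sem M (NegAtom a) e = {s \<in> states M. a \<notin> label M s}"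
| "sem M (Var Z) e = e Z"
| "sem M (Next c p f) e = {s \<in> states M. cmp_holds c (\<Sum>t\<in>sem M f e. trans M s t) p}"
| "sem M (And f g) e = sem M f e \<inter> sem M g e"
| "sem M (Or f g) e = sem M f e \<union> sem M g e"
| "sem M (Mu Z f) e = lfp (\<lambda>X. sem M f (e(Z := X \<inter> states M)))"
| "sem M (Nu Z f) e = gfp (\<lambda>X. sem M f (e(Z := X \<inter> states M)))"

text \<open>For closed formulas the assignment is irrelevant (\<open>sem_closed\<close> below).\<close>

definition sem0 :: "('s, 'a) mc \<Rightarrow> ('a, 'z) pmutl \<Rightarrow> 's set" where
  "sem0 M f = sem M f (\<lambda>_. {})"


section \<open>Adequacy of the semantics\<close>

lemma sem_cong:
  "(\<And>Z. Z \<in> free_vars f \<Longrightarrow> e Z = e' Z) \<Longrightarrow> sem M f e = sem M f e'"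
proof (induction f arbitrary: e e')
  case (Next c p f)
  have "sem M f e = sem M f e'" by (rule Next.IH) (use Next.prems in auto)
  then show ?case by (simp only: sem.simps)
next
  case (And f g)
  have "sem M f e = sem M f e'" by (rule And.IH) (use And.prems in auto)
  moreover have "sem M g e = sem M g e'" by (rule And.IH) (use And.prems in auto)
  ultimately show ?case by (simp only: sem.simps)
next
  case (Or f g)
  have "sem M f e = sem M f e'" by (rule Or.IH) (use Or.prems in auto)
  moreover have "sem M g e = sem M g e'" by (rule Or.IH) (use Or.prems in auto)
  ultimately show ?case by (simp only: sem.simps)
next
  case (Mu Z f)
  have "sem M f (e(Z := X)) = sem M f (e'(Z := X))" for X
    by (rule Mu.IH) (use Mu.prems in auto)
  then show ?case by (simp only: sem.simps)
next
  case (Nu Z f)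
  have "sem M f (e(Z := X)) = sem M f (e'(Z := X))" for X
    by (rule Nu.IH) (use Nu.prems in auto)
  then show ?case by (simp only: sem.simps)
qed auto

lemma sem_closed:
  "closed_pmutl f \<Longrightarrow> sem M f e = sem0 M f"
  unfolding sem0_def closed_pmutl_def by (rule sem_cong) simp

lemma sem_subset_states:
  "(\<And>Z. e Z \<subseteq> states M) \<Longrightarrow> sem M f e \<subseteq> states M"
proof (induction f arbitrary: e)
  case (Mu Z f)
  have "sem M f (e(Z := states M)) \<subseteq> states M"
    by (rule Mu.IH) (use Mu.prems in auto)
  then show ?case by (auto intro!: lfp_lowerbound)
next
  case (Nu Z f)
  have "sem M f (e(Z := X \<inter> states M)) \<subseteq> states M" for X
    by (rule Nu.IH) (use Nu.prems in auto)
  then have "X \<subseteq> states M" if "X \<subseteq> sem M f (e(Z := X \<inter> states M))" for X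
    using that by blast
  then show ?case by (auto simp: gfp_def)
qed auto

lemma sem_mono:
  assumes "markov_chain M"
  shows "(\<And>Z. e Z \<subseteq> e' Z) \<Longrightarrow> (\<And>Z. e' Z \<subseteq> states M) \<Longrightarrow> sem M f e \<subseteq> sem M f e'"
proof (induction f arbitrary: e e')
  case (Next c p f)
  have sub: "sem M f e \<subseteq> sem M f e'" "sem M f e' \<subseteq> states M"
    using Next.IH Next.prems sem_subset_states[of e' M f] by auto
  have "(\<Sum>t\<in>sem M f e. trans M s t) \<le> (\<Sum>t\<in>sem M f e'. trans M s t)" if "s \<in> states M" for s
    using sub that assms
    by (intro sum_mono2) (auto simp: markov_chain_def intro: finite_subset)
  then show ?case
    by (cases c) (auto intro: less_le_trans order_trans)
next
  case (And f g)
  then have "sem M f e \<subseteq> sem M f e'" "sem M g e \<subseteq> sem M g e'" by blast+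
  then show ?case by auto
next
  case (Or f g)
  then have "sem M f e \<subseteq> sem M f e'" "sem M g e \<subseteq> sem M g e'" by blast+
  then show ?case by auto
next
  case (Mu Z f)
  have "sem M f (e(Z := X \<inter> states M)) \<subseteq> sem M f (e'(Z := X \<inter> states M))" for X
    by (rule Mu.IH) (use Mu.prems in auto)
  then show ?case by (auto intro!: lfp_mono)
next
  case (Nu Z f)
  have "sem M f (e(Z := X \<inter> states M)) \<subseteq> sem M f (e'(Z := X \<inter> states M))" for X
    by (rule Nu.IH) (use Nu.prems in auto)
  then show ?case by (auto intro!: gfp_mono)
qed auto

lemma mono_sem_upd:
  assumes "markov_chain M" "\<And>Z. e Z \<subseteq> states M"
  shows "mono (\<lambda>X. sem M f (e(Z := X \<inter> states M)))"
  by (rule monoI, rule sem_mono[OF assms(1)]) (use assms(2) in auto)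

lemma sem_Mu_least:
  assumes "markov_chain M" "\<And>Z. e Z \<subseteq> states M"
  shows "sem M (Mu Z f) e \<subseteq> states M"
    and "sem M f (e(Z := sem M (Mu Z f) e)) = sem M (Mu Z f) e"
    and "\<And>Y. Y \<subseteq> states M \<Longrightarrow> sem M f (e(Z := Y)) = Y \<Longrightarrow> sem M (Mu Z f) e \<subseteq> Y"
proof -
  show sub: "sem M (Mu Z f) e \<subseteq> states M"
    by (rule sem_subset_states) (use assms in auto)
  show "sem M f (e(Z := sem M (Mu Z f) e)) = sem M (Mu Z f) e"
    using lfp_unfold[OF mono_sem_upd[where f=f and e=e and Z=Z, OF assms]] sub
    by (simp add: Int_absorb2)
  show "sem M (Mu Z f) e \<subseteq> Y" if "Y \<subseteq> states M" "sem M f (e(Z := Y)) = Y" for Y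
    using that by (auto simp: Int_absorb2 intro!: lfp_lowerbound)
qed

lemma sem_Nu_greatest:
  assumes "markov_chain M" "\<And>Z. e Z \<subseteq> states M"
  shows "sem M (Nu Z f) e \<subseteq> states M"
    and "sem M f (e(Z := sem M (Nu Z f) e)) = sem M (Nu Z f) e"
    and "\<And>Y. Y \<subseteq> states M \<Longrightarrow> sem M f (e(Z := Y)) = Y \<Longrightarrow> Y \<subseteq> sem M (Nu Z f) e"
proof -
  show sub: "sem M (Nu Z f) e \<subseteq> states M"
    by (rule sem_subset_states) (use assms in auto)
  show "sem M f (e(Z := sem M (Nu Z f) e)) = sem M (Nu Z f) e"
    using gfp_unfold[OF mono_sem_upd[where f=f and e=e and Z=Z, OF assms]] sub
    by (simp add: Int_absorb2)
  show "Y \<subseteq> sem M (Nu Z f) e" if Y: "Y \<subseteq> states M" "sem M f (e(Z := Y)) = Y" for Y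
  proof -
    have "Y \<subseteq> sem M f (e(Z := Y \<inter> states M))" using Y by (simp add: Int_absorb2)
    then show ?thesis by (simp add: gfp_upperbound)
  qed
qed


section \<open>Existence and uniqueness of the path measure\<close>

lemma cylinder_Int:
  "cylinder M s w n \<inter> cylinder M s v m \<in> insert {} {cylinder M s w n |w n. True}"
proof (cases "cylinder M s w n \<inter> cylinder M s v m = {}")
  case False
  then obtain u where u: "\<forall>i\<le>n. u i = w i" "\<forall>i\<le>m. u i = v i"
    by (auto simp: cylinder_def)
  have "cylinder M s w n \<inter> cylinder M s v m = cylinder M s u (max n m)"
    using u by (auto simp: cylinder_def le_max_iff_disj)
  then show ?thesis by auto
qed simp

lemma is_path_measure_unique:
  assumes M: "markov_chain M" and s: "s \<in> states M"
    and P: "is_path_measure M s P" and Q: "is_path_measure M s Q"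
  shows "P = Q"
proof -
  let ?C = "{cylinder M s w n |w n. True}"
  let ?E = "insert {} ?C"
  have E: "sigma_sets (paths M s) ?E = sigma_sets (paths M s) ?C"
    by (rule sigma_sets_eqI) (auto intro: sigma_sets.Empty)
  interpret P: prob_space P using P by (simp add: is_path_measure_def)
  interpret Q: prob_space Q using Q by (simp add: is_path_measure_def)
  have eq: "measure P (cylinder M s w n) = measure Q (cylinder M s w n)" for w n
  proof (cases "cylinder M s w n = {}")
    case False
    then obtain \<pi> where "\<pi> \<in> paths M s" "\<forall>i\<le>n. \<pi> i = w i"
      by (auto simp: cylinder_def)
    then have "w 0 = s" "\<forall>i\<le>n. w i \<in> states M"
      unfolding paths_def by (metis (mono_tags, lifting) mem_Collect_eq zero_le)+
    then show ?thesis using P Q by (simp add: is_path_measure_def)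
  qed simp
  have all: "paths M s = cylinder M s (\<lambda>_. s) 0"
    by (auto simp: cylinder_def paths_def)
  show ?thesis
  proof (rule measure_eqI_generator_eq[where E = ?E and \<Omega> = "paths M s" and A = "\<lambda>_. paths M s"])
    show "Int_stable ?E"
    proof (rule Int_stableI)
      fix a b assume "a \<in> ?E" "b \<in> ?E"
      then consider "a = {} \<or> b = {}"
        | w n v m where "a = cylinder M s w n" "b = cylinder M s v m" by blast
      then show "a \<inter> b \<in> ?E"
      proof cases
        case 2
        then show ?thesis using cylinder_Int[of M s w n v m] by simp
      qed auto
    qed
    show "?E \<subseteq> Pow (paths M s)" by (auto simp: cylinder_def)
    show "sets P = sigma_sets (paths M s) ?E" "sets Q = sigma_sets (paths M s) ?E"
      using P Q E by (simp_all add: is_path_measure_def)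
    show "emeasure P X = emeasure Q X" if "X \<in> ?E" for X
      using that eq by (auto simp: P.emeasure_eq_measure Q.emeasure_eq_measure)
    show "range (\<lambda>_. paths M s) \<subseteq> ?E"
      using all by auto
  qed (auto simp: P.emeasure_eq_measure)
qed

lemma ex_path_measure:
  fixes M :: "('s, 'a) mc"
  assumes M: "markov_chain M" and s: "s \<in> states M"
  shows "\<exists>P. is_path_measure M s P"
proof -
  define S where "S = states M"
  define T where "T = trans M"
  have fin: "finite S" and T0: "\<And>u v. u \<in> S \<Longrightarrow> v \<in> S \<Longrightarrow> 0 \<le> T u v"
    and T1: "\<And>u. u \<in> S \<Longrightarrow> (\<Sum>v\<in>S. T u v) = 1" and sS: "s \<in> S"
    using M s by (auto simp: markov_chain_def S_def T_def)
  define N :: "nat \<Rightarrow> 's measure" where "N = (\<lambda>_. count_space S)"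
  define K where "K = (\<lambda>u. point_measure S (\<lambda>v. ennreal (T u v)))"
  define R where "R = (\<lambda>i \<omega>. if i = 0 then return (count_space S) s else K (\<omega> (i - 1 :: nat)))"
  have K_prob: "prob_space (K u)" if "u \<in> S" for u
  proof
    show "emeasure (K u) (space (K u)) = 1"
      using that fin T0 T1
      by (simp add: K_def space_point_measure emeasure_point_measure_finite sum_ennreal)
  qed
  have K_meas: "K \<in> measurable (count_space S) (subprob_algebra (count_space S))"
  proof -
    have "K u \<in> space (subprob_algebra (count_space S))" if "u \<in> S" for u
      using K_prob[OF that]
      by (auto simp: space_subprob_algebra K_def sets_point_measure prob_space_imp_subprob_space)
    then show ?thesis by auto
  qed
  have R_meas: "R i \<in> measurable (PiM {0..<i} N) (subprob_algebra (N i))" for i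
  proof (cases "i = 0")
    case True
    then show ?thesis
      using sS measurable_space[OF return_measurable[of "count_space S"], of s]
      by (auto simp: R_def N_def intro!: measurable_const)
  next
    case False
    then have "(\<lambda>\<omega>. \<omega> (i - 1)) \<in> measurable (PiM {0..<i} N) (count_space S)"
      using measurable_component_singleton[of "i - 1" "{0..<i}" N] by (simp add: N_def)
    from measurable_compose[OF this K_meas] False show ?thesis
      by (simp add: R_def N_def)
  qed
  have R_prob: "prob_space (R i x)" if x: "x \<in> space (PiM {0..<i} N)" for i x
  proof (cases "i = 0")
    case True
    then show ?thesis using sS by (auto simp: R_def intro!: prob_space_return)
  next
    case False
    then have "x (i - 1) \<in> S" using x by (auto simp: space_PiM N_def PiE_iff)
    then show ?thesis using False K_prob by (simp add: R_def)
  qed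
  interpret IT: Ionescu_Tulcea R N
    by (rule Ionescu_Tulcea.intro) (fact R_meas, fact R_prob)
  define L where "L = IT.PF.lim"
  have space_N: "space (PiM I N) = (\<Pi>\<^sub>E i\<in>I. S)" for I
    by (simp add: space_PiM N_def)
  have sing: "{restrict w {0..<n}} \<in> sets (PiM {0..<n} N)" if "\<forall>i<n. w i \<in> S" for w n
  proof -
    have "{restrict w {0..<n}} = (\<Pi>\<^sub>E i\<in>{0..<n}. {w i})"
      by (auto simp: PiE_iff extensional_def restrict_def fun_eq_iff)
    also have "\<dots> \<in> sets (PiM {0..<n} N)"
      by (rule sets_PiM_I_finite) (use that in \<open>auto simp: N_def\<close>)
    finally show ?thesis .
  qed
  have C_step: "emeasure (IT.C 0 (Suc n) (\<lambda>_. undefined)) {restrict w {0..<Suc n}} =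
      emeasure (R n (restrict w {0..<n})) {w n} *
      emeasure (IT.C 0 n (\<lambda>_. undefined)) {restrict w {0..<n}}"
    if w: "\<forall>i<Suc n. w i \<in> S" for w n
  proof -
    have u: "(\<lambda>_. undefined) \<in> space (PiM {0..<0::nat} N)" by (simp add: space_PiM)
    note sp = IT.space_C[OF u, of n, simplified] and st = IT.sets_C[OF u, of n, simplified]
    let ?D = "IT.C 0 n (\<lambda>_. undefined)"
    have meas: "IT.eP n \<in> measurable ?D (subprob_algebra (PiM {0..<Suc n} N))"
      using IT.measurable_eP[of n] by (simp add: measurable_cong_sets[OF st refl])
    have ne: "space ?D \<noteq> {}"
      using prob_space.not_empty[OF IT.prob_space_C[OF u, of n]] .
    have w': "restrict w {0..<n} \<in> space (PiM {0..<n} N)"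
      using w by (auto simp: space_N)
    have "emeasure (IT.C 0 (Suc n) (\<lambda>_. undefined)) {restrict w {0..<Suc n}} =
        (\<integral>\<^sup>+x. emeasure (IT.eP n x) {restrict w {0..<Suc n}} \<partial>?D)"
      using emeasure_bind[OF ne meas sing[OF w]] by simp
    also have "\<dots> = (\<integral>\<^sup>+x. emeasure (R n (restrict w {0..<n})) {w n} *
        indicator {restrict w {0..<n}} x \<partial>?D)"
    proof (rule nn_integral_cong)
      fix x assume "x \<in> space ?D"
      then have x: "x \<in> space (PiM {0..<n} N)" using sp by simp
      have xe: "x \<in> extensional {0..<n}" using x by (auto simp: space_N PiE_iff)
      have "emeasure (IT.eP n x) {restrict w {0..<Suc n}} =
          emeasure (R n x) ((\<lambda>y. x(n := y)) -` {restrict w {0..<Suc n}} \<inter> S)"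
        using IT.emeasure_eP[OF x sing[OF w]] by (simp add: N_def)
      also have "(\<lambda>y. x(n := y)) -` {restrict w {0..<Suc n}} \<inter> S =
          (if x = restrict w {0..<n} then {w n} else {})"
      proof (cases "x = restrict w {0..<n}")
        case True
        have "(restrict w {0..<n})(n := y) = restrict w {0..<Suc n} \<longleftrightarrow> y = w n" for y
          by (auto simp: fun_eq_iff restrict_def less_Suc_eq)
        then show ?thesis using True w by auto
      next
        case False
        have "x = restrict w {0..<n}" if "x(n := y) = restrict w {0..<Suc n}" for y
        proof
          fix i
          show "x i = restrict w {0..<n} i"
            using fun_cong[OF that, of i] xe
            by (cases "i < n") (auto simp: extensional_def restrict_def split: if_splits)
        qed
        then show ?thesis using False by auto
      qed
      finally show "emeasure (IT.eP n x) {restrict w {0..<Suc n}} =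
          emeasure (R n (restrict w {0..<n})) {w n} * indicator {restrict w {0..<n}} x"
        by (cases "x = restrict w {0..<n}") (simp_all del: restrict_apply)
    qed
    also have "\<dots> = emeasure (R n (restrict w {0..<n})) {w n} * emeasure ?D {restrict w {0..<n}}"
      by (rule nn_integral_cmult_indicator) (use w sing[of n w] st in auto)
    finally show ?thesis .
  qed
  define c where "c = (\<lambda>w n. emeasure (IT.C 0 n (\<lambda>_. undefined)) {restrict w {0..<n}})"
  have c_0: "c w 0 = 1" for w
    using sing[of 0 w] by (simp add: c_def emeasure_return restrict_def)
  have c_Suc: "c w (Suc n) = emeasure (R n (restrict w {0..<n})) {w n} * c w n"
    if "\<forall>i<Suc n. w i \<in> S" for w n
    unfolding c_def by (rule C_step[OF that])
  have c_val: "c w (Suc n) = ennreal (\<Prod>i<n. T (w i) (w (Suc i)))"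
    if "w 0 = s" "\<forall>i\<le>n. w i \<in> S" for w n
    using that(2)
  proof (induction n)
    case 0
    have "emeasure (R 0 (restrict w {0..<0})) {w 0} = 1"
      using that(1) sS by (simp add: R_def)
    then show ?case
      using c_Suc[of 0 w] c_0[of w] 0 by (simp only:) simp
  next
    case (Suc n)
    have in_S: "w n \<in> S" "w (Suc n) \<in> S" using Suc.prems by auto
    have "c w (Suc (Suc n)) = emeasure (R (Suc n) (restrict w {0..<Suc n})) {w (Suc n)} * c w (Suc n)"
      by (rule c_Suc) (use Suc.prems in auto)
    also have "emeasure (R (Suc n) (restrict w {0..<Suc n})) {w (Suc n)} = ennreal (T (w n) (w (Suc n)))"
      using in_S fin by (simp add: R_def K_def emeasure_point_measure_finite)
    also have "c w (Suc n) = ennreal (\<Prod>i<n. T (w i) (w (Suc i)))"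
      using Suc.IH Suc.prems by simp
    also have "ennreal (T (w n) (w (Suc n))) * ennreal (\<Prod>i<n. T (w i) (w (Suc i))) =
        ennreal (T (w n) (w (Suc n)) * (\<Prod>i<n. T (w i) (w (Suc i))))"
    proof (rule ennreal_mult[symmetric])
      show "0 \<le> (\<Prod>i<n. T (w i) (w (Suc i)))"
        using Suc.prems by (intro prod_nonneg) (auto intro!: T0)
    qed (rule T0[OF in_S])
    also have "T (w n) (w (Suc n)) * (\<Prod>i<n. T (w i) (w (Suc i))) = (\<Prod>i<Suc n. T (w i) (w (Suc i)))"
      by (simp add: mult.commute)
    finally show ?case .
  qed
  define B where "B = (\<lambda>w n. {\<pi> \<in> space L. \<forall>i\<le>n. \<pi> i = w i})"
  have space_L: "space L = UNIV \<rightarrow>\<^sub>E S" by (simp add: L_def space_N)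
  have sets_L: "sets L = sets (PiM UNIV N)" by (simp add: L_def)
  have comp: "(\<lambda>\<pi>. \<pi> i) \<in> measurable L (count_space S)" for i
    using measurable_component_singleton[of i UNIV N]
    by (simp add: measurable_cong_sets[OF sets_L refl] N_def)
  have comp_eq: "{\<pi> \<in> space L. \<pi> i = v} \<in> sets L" for i v
  proof (cases "v \<in> S")
    case True
    then show ?thesis
      using measurable_sets[OF comp[of i], of "{v}"] by (simp add: vimage_def Int_def conj_commute)
  next
    case False
    then have "{\<pi> \<in> space L. \<pi> i = v} = {}" by (auto simp: space_L PiE_iff)
    then show ?thesis by (simp only: sets.empty_sets)
  qed
  have B_sets: "B w n \<in> sets L" for w n
  proof -
    have "B w n = (\<Inter>i\<in>{..n}. {\<pi> \<in> space L. \<pi> i = w i})" by (auto simp: B_def)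
    also have "\<dots> \<in> sets L" by (rule sets.finite_INT) (use comp_eq in auto)
    finally show ?thesis .
  qed
  have B_val: "emeasure L (B w n) = ennreal (\<Prod>i<n. T (w i) (w (Suc i)))"
    if w: "w 0 = s" "\<forall>i\<le>n. w i \<in> S" for w n
  proof -
    let ?X = "{restrict w {0..<Suc n}}"
    have X: "?X \<in> sets (PiM {0..<Suc n} N)" using w by (intro sing) auto
    have "restrict x {0..<Suc n} = restrict w {0..<Suc n} \<longleftrightarrow> (\<forall>i\<le>n. x i = w i)" for x
    proof
      assume eq: "restrict x {0..<Suc n} = restrict w {0..<Suc n}"
      show "\<forall>i\<le>n. x i = w i"
      proof (intro allI impI)
        fix i assume "i \<le> n"
        then show "x i = w i" using fun_cong[OF eq, of i] by simp
      qed
    qed (auto simp: fun_eq_iff restrict_def)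
    then have "B w n = IT.PF.emb UNIV {0..<Suc n} ?X"
      by (auto simp: B_def prod_emb_def space_L N_def simp del: restrict_apply)
    then have "emeasure L (B w n) = emeasure (IT.CI {0..<Suc n}) ?X"
      using IT.lim[OF _ X] by (simp add: L_def)
    also have "\<dots> = emeasure (IT.C 0 (Suc n) (\<lambda>_. undefined)) (IT.PF.emb {0..<Suc n} {0..<Suc n} ?X)"
      by (rule IT.emeasure_CI[OF _ X]) simp
    also have "IT.PF.emb {0..<Suc n} {0..<Suc n} ?X = ?X"
      using sets.sets_into_space[OF X] by (intro prod_emb_id) (simp add: space_PiM)
    finally show ?thesis using c_val[OF w] by (simp only: c_def)
  qed
  interpret L: prob_space L
    unfolding L_def
  proof
    have "prob_space (IT.CI {})" by (rule IT.PF.prob_space_P) auto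
    then have *: "emeasure (IT.CI {}) (space (PiM {} N)) = 1"
      using prob_space.emeasure_space_1[of "IT.CI {}"] by (simp add: IT.CI_def)
    have "IT.PF.emb UNIV {} (space (PiM {} N)) = space (PiM UNIV N)"
      by (auto simp: prod_emb_def space_PiM)
    then show "emeasure IT.PF.lim (space IT.PF.lim) = 1"
      using IT.lim[of "{}" "space (PiM {} N)"] * by simp
  qed
  have paths_eq: "paths M s = {\<pi> \<in> space L. \<pi> 0 = s \<and> (\<forall>i. T (\<pi> i) (\<pi> (Suc i)) > 0)}"
    by (auto simp: paths_def space_L S_def T_def)
  have AE0: "AE \<pi> in L. \<pi> 0 = s"
  proof (rule L.AE_I_eq_1)
    have "{\<pi> \<in> space L. \<pi> 0 = s} = B (\<lambda>_. s) 0" by (auto simp: B_def)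
    then show "emeasure L {\<pi> \<in> space L. \<pi> 0 = s} = 1" "{\<pi> \<in> space L. \<pi> 0 = s} \<in> sets L"
      using B_val[of "\<lambda>_. s" 0] B_sets sS by simp_all
  qed
  have AE_T: "AE \<pi> in L. T (\<pi> i) (\<pi> (Suc i)) > 0" for i
  proof -
    let ?W = "{w \<in> PiE {..Suc i} (\<lambda>_. S). w 0 = s \<and> \<not> T (w i) (w (Suc i)) > 0}"
    have "finite (PiE {..Suc i} (\<lambda>_. S))" by (rule finite_PiE) (use fin in auto)
    then have finW: "finite ?W" by simp
    have "B w (Suc i) \<in> null_sets L" if "w \<in> ?W" for w
    proof -
      have w: "w 0 = s" "\<forall>j\<le>Suc i. w j \<in> S" using that by (auto simp: PiE_iff)
      have "T (w i) (w (Suc i)) = 0"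
        using that w T0[of "w i" "w (Suc i)"] by auto
      then have "emeasure L (B w (Suc i)) = 0" using B_val[OF w] by simp
      then show ?thesis using B_sets by (auto intro: null_setsI)
    qed
    then have "(\<Union>w\<in>?W. B w (Suc i)) \<in> null_sets L"
      using finW by (intro null_sets_UN') (auto intro: countable_finite)
    then have "AE \<pi> in L. \<pi> \<notin> (\<Union>w\<in>?W. B w (Suc i))" by (rule AE_not_in)
    with AE0 AE_space show ?thesis
    proof eventually_elim
      case (elim \<pi>)
      show ?case
      proof (rule ccontr)
        assume "\<not> T (\<pi> i) (\<pi> (Suc i)) > 0"
        then have "restrict \<pi> {..Suc i} \<in> ?W"
          using elim by (auto simp: space_L PiE_iff)
        moreover have "\<pi> \<in> B (restrict \<pi> {..Suc i}) (Suc i)"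
          using elim by (auto simp: B_def)
        ultimately show False using elim by blast
      qed
    qed
  qed
  have AE_paths: "AE \<pi> in L. \<pi> \<in> paths M s"
  proof -
    have "AE \<pi> in L. \<forall>i. T (\<pi> i) (\<pi> (Suc i)) > 0"
      using AE_T by (simp add: AE_all_countable)
    with AE0 AE_space show ?thesis by eventually_elim (simp add: paths_eq)
  qed
  have T_sets: "{\<pi> \<in> space L. T (\<pi> i) (\<pi> (Suc i)) > 0} \<in> sets L" for i
  proof -
    have "{\<pi> \<in> space L. T (\<pi> i) (\<pi> (Suc i)) > 0} =
        (\<Union>(u, v)\<in>{(u, v) \<in> S \<times> S. T u v > 0}. {\<pi> \<in> space L. \<pi> i = u} \<inter> {\<pi> \<in> space L. \<pi> (Suc i) = v})"
      by (auto simp: space_L PiE_iff)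
    moreover have "finite {(u, v) \<in> S \<times> S. T u v > 0}"
      by (rule finite_subset[of _ "S \<times> S"]) (use fin in auto)
    ultimately show ?thesis
      using comp_eq by (auto intro!: sets.finite_UN)
  qed
  have paths_sets: "paths M s \<in> sets L"
  proof -
    have "{\<pi> \<in> space L. \<forall>i. T (\<pi> i) (\<pi> (Suc i)) > 0} \<in> sets L"
      by (rule sets.sets_Collect_countable_All) (rule T_sets)
    then have "{\<pi> \<in> space L. \<pi> 0 = s} \<inter> {\<pi> \<in> space L. \<forall>i. T (\<pi> i) (\<pi> (Suc i)) > 0} \<in> sets L"
      using comp_eq by blast
    moreover have "{\<pi> \<in> space L. \<pi> 0 = s} \<inter> {\<pi> \<in> space L. \<forall>i. T (\<pi> i) (\<pi> (Suc i)) > 0} = paths M s"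
      by (auto simp: paths_eq)
    ultimately show ?thesis by simp
  qed
  have "paths M s \<noteq> {}"
  proof
    assume "paths M s = {}"
    with AE_paths have "AE \<pi> in L. False" by simp
    then show False by simp
  qed
  then obtain \<pi>\<^sub>0 where \<pi>\<^sub>0: "\<pi>\<^sub>0 \<in> paths M s" by auto
  let ?C = "{cylinder M s w n |w n. True}"
  define G where "G = sigma (paths M s) ?C"
  have C_Pow: "?C \<subseteq> Pow (paths M s)" by (auto simp: cylinder_def)
  have space_G: "space G = paths M s" and sets_G: "sets G = sigma_sets (paths M s) ?C"
    using C_Pow by (simp_all add: G_def space_measure_of sets_measure_of)
  define g where "g = (\<lambda>\<pi>. if \<pi> \<in> paths M s then \<pi> else \<pi>\<^sub>0)"
  have paths_space: "paths M s \<subseteq> space L" by (auto simp: paths_eq)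
  have g: "g \<in> measurable L G"
    unfolding G_def
  proof (rule measurable_measure_of[OF C_Pow])
    show "g \<in> space L \<rightarrow> paths M s" using \<pi>\<^sub>0 by (auto simp: g_def)
    fix A assume "A \<in> ?C"
    then obtain w n where A: "A = cylinder M s w n" by auto
    have "g -` A \<inter> space L = (B w n \<inter> paths M s) \<union> (if \<pi>\<^sub>0 \<in> A then space L - paths M s else {})"
      using paths_space by (auto simp: g_def A B_def cylinder_def split: if_splits)
    then show "g -` A \<inter> space L \<in> sets L"
      using B_sets paths_sets by auto
  qed
  have "is_path_measure M s (distr L G g)"
    unfolding is_path_measure_def
  proof (intro conjI allI impI)
    show "prob_space (distr L G g)" by (rule L.prob_space_distr[OF g])
    show "space (distr L G g) = paths M s" by (simp add: space_G)
    show "sets (distr L G g) = sigma_sets (paths M s) ?C" by (simp add: sets_G)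
    fix w :: "nat \<Rightarrow> 's" and n assume w: "w 0 = s \<and> (\<forall>i\<le>n. w i \<in> states M)"
    have cyl: "cylinder M s w n \<in> sets G" by (auto simp: sets_G)
    have "measure (distr L G g) (cylinder M s w n) = measure L (g -` cylinder M s w n \<inter> space L)"
      by (rule measure_distr[OF g cyl])
    also have "\<dots> = measure L (B w n)"
    proof (rule L.finite_measure_eq_AE)
      show "AE \<pi> in L. (\<pi> \<in> g -` cylinder M s w n \<inter> space L) = (\<pi> \<in> B w n)"
        using AE_paths by eventually_elim (use paths_space in \<open>auto simp: g_def B_def cylinder_def\<close>)
    qed (use measurable_sets[OF g cyl] B_sets in auto)
    also have "\<dots> = (\<Prod>i<n. trans M (w i) (w (Suc i)))"
    proof -
      have "0 \<le> (\<Prod>i<n. T (w i) (w (Suc i)))"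
        using w by (intro prod_nonneg) (auto intro!: T0 simp: S_def)
      then show ?thesis
        using B_val[of w n] w by (simp add: S_def T_def measure_def)
    qed
    finally show "measure (distr L G g) (cylinder M s w n) = (\<Prod>i<n. trans M (w i) (w (Suc i)))" .
  qed
  then show ?thesis by blast
qed

lemma ex1_path_measure:
  assumes "markov_chain M" "s \<in> states M"
  shows "\<exists>!P. is_path_measure M s P"
  using ex_path_measure[OF assms] is_path_measure_unique[OF assms] by blast

lemma is_path_measure_path_measure:
  assumes "markov_chain M" "s \<in> states M"
  shows "is_path_measure M s (path_measure M s)"
  unfolding path_measure_def by (rule theI'[OF ex1_path_measure[OF assms]])

end

(* A fixed formula mentions only finitely many thresholds. In the chain below, state 2 is reached from
   state 0 with probability p * q, and p * q = 1/2 can be arranged with q and 1 - q avoiding all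
   thresholds. A small decrease of q then changes no comparison "one-step probability of X ~ threshold",
   hence not the semantics of the formula, but it brings the reachability probability below 1/2. *)
theory Submission
  imports Defs
begin

primrec thresholds :: "('a, 'z) pmutl \<Rightarrow> real set" where
  "thresholds Top = {}"
| "thresholds Bot = {}"
| "thresholds (Atom a) = {}"
| "thresholds (NegAtom a) = {}"
| "thresholds (Var Z) = {}"
| "thresholds (Next c p f) = insert p (thresholds f)"
| "thresholds (And f g) = thresholds f \<union> thresholds g"
| "thresholds (Or f g) = thresholds f \<union> thresholds g"
| "thresholds (Mu Z f) = thresholds f"
| "thresholds (Nu Z f) = thresholds f"

lemma finite_thresholds: "finite (thresholds f)"
  by (induction f) auto

text \<open>The semantics reads transition probabilities only in the \<open>Next\<close> case, so
  two chains that agree on all those comparisons cannot be told apart by \<open>f\<close>.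
  Comparisons are assumed only for sets of states, hence the bound on \<open>e\<close>.\<close>

lemma sem_eq_of_thresholds:
  assumes states: "states N = states M"
    and label: "\<And>s. s \<in> states M \<Longrightarrow> label N s = label M s"
    and "\<And>s X c p. s \<in> states M \<Longrightarrow> X \<subseteq> states M \<Longrightarrow> p \<in> thresholds f \<Longrightarrow>
      cmp_holds c (\<Sum>t\<in>X. trans M s t) p \<longleftrightarrow> cmp_holds c (\<Sum>t\<in>X. trans N s t) p"
    and "\<And>Z. e Z \<subseteq> states M"
  shows "sem M f e = sem N f e"
  using assms(3,4)
proof (induction f arbitrary: e)
  case (Next c p f)
  have "sem M f e = sem N f e"
    by (rule Next.IH) (use Next.prems in auto)
  moreover have "sem M f e \<subseteq> states M"
    using Next.prems(2) by (rule sem_subset_states)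
  ultimately show ?case
    using Next.prems(1) states by auto
next
  case (And f g)
  have "sem M f e = sem N f e" "sem M g e = sem N g e"
    by (rule And.IH; use And.prems in auto)+
  then show ?case by simp
next
  case (Or f g)
  have "sem M f e = sem N f e" "sem M g e = sem N g e"
    by (rule Or.IH; use Or.prems in auto)+
  then show ?case by simp
next
  case (Mu Z f)
  \<comment> \<open>The intersection keeps the updated assignment inside the carrier, so the
    induction hypothesis applies to every \<open>X\<close>: the two functionals are equal, and so
    are their fixpoints.\<close>
  have "sem M f (e(Z := X \<inter> states M)) = sem N f (e(Z := X \<inter> states M))" for X
    by (rule Mu.IH) (use Mu.prems in auto)
  then show ?case by (simp add: states)
next
  case (Nu Z f)
  have "sem M f (e(Z := X \<inter> states M)) = sem N f (e(Z := X \<inter> states M))" for X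
    by (rule Nu.IH) (use Nu.prems in auto)
  then show ?case by (simp add: states)
qed (auto simp: states label)

text \<open>State 2 is the target and state 3 a trap. With a single random step the reachability
  probability would itself be a one-step probability, which \<open>Next\<close> can compare with
  1/2; two steps turn it into a product that no single comparison sees.\<close>

definition two_step_trans :: "real \<Rightarrow> real \<Rightarrow> nat \<Rightarrow> nat \<Rightarrow> real" where
  "two_step_trans p q s t =
     (if s = 0 then (if t = 1 then p else if t = 3 then 1 - p else 0)
      else if s = 1 then (if t = 2 then q else if t = 3 then 1 - q else 0)
      else if t = s then 1 else 0)"

definition two_step_chain :: "'a \<Rightarrow> real \<Rightarrow> real \<Rightarrow> (nat, 'a) mc" where
  "two_step_chain a p q =
     \<lparr>states = {0, 1, 2, 3}, trans = two_step_trans p q, label = (\<lambda>s. if s = 2 then {a} else {})\<rparr>"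

lemma two_step_chain_simps [simp]:
  "states (two_step_chain a p q) = {0, 1, 2, 3}"
  "trans (two_step_chain a p q) = two_step_trans p q"
  "label (two_step_chain a p q) = (\<lambda>s. if s = 2 then {a} else {})"
  by (simp_all add: two_step_chain_def)

lemma markov_chain_two_step_chain:
  assumes "0 \<le> p" "p \<le> 1" "0 \<le> q" "q \<le> 1"
  shows "markov_chain (two_step_chain a p q)"
  using assms by (auto simp: markov_chain_def two_step_trans_def)

text \<open>State 3 is absorbing, so a path that visits 2 never meets 3 before and must start with
  0, 1, 2. The event thus becomes one cylinder, whose measure is known.\<close>

lemma reach_eq_cylinder:
  "{\<pi> \<in> paths (two_step_chain a p q) 0. \<exists>i. a \<in> label (two_step_chain a p q) (\<pi> i)} =
   cylinder (two_step_chain a p q) 0 (\<lambda>i. i) 2" (is "?R = ?C")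
proof
  show "?C \<subseteq> ?R"
    by (auto simp: cylinder_def)
  show "?R \<subseteq> ?C"
  proof
    fix \<pi> assume "\<pi> \<in> ?R"
    then obtain i where \<pi>: "\<pi> \<in> paths (two_step_chain a p q) 0" and i: "\<pi> i = 2"
      by (auto split: if_splits)
    have \<pi>0: "\<pi> 0 = 0" and st: "two_step_trans p q (\<pi> j) (\<pi> (Suc j)) > 0" for j
      using \<pi> by (auto simp: paths_def)
    have sink: "\<pi> (j + k) = 3" if "\<pi> j = 3" for j k
    proof (induction k)
      case (Suc k)
      then show ?case
        using st[of "j + k"] by (auto simp: two_step_trans_def split: if_splits)
    qed (use that in simp)
    have "\<pi> j \<noteq> 3" if "j \<le> i" for j
      using sink[of j "i - j"] that i by auto
    moreover have "i \<noteq> 0" using i \<pi>0 by (intro notI) simp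
    ultimately have \<pi>1: "\<pi> 1 = 1"
      using st[of 0] \<pi>0 by (auto simp: two_step_trans_def split: if_splits)
    then have "i \<noteq> 1" using i by (intro notI) simp
    with \<open>i \<noteq> 0\<close> have "2 \<le> i" by simp
    then have "\<pi> 2 \<noteq> 3" by fact
    then have "\<pi> 2 = 2"
      using st[of 1] \<pi>1 by (auto simp: two_step_trans_def numeral_2_eq_2 split: if_splits)
    with \<pi> \<pi>0 \<pi>1 show "\<pi> \<in> ?C"
      by (auto simp: cylinder_def numeral_2_eq_2 le_Suc_eq)
  qed
qed

lemma two_step_chain_sat_F_ge:
  assumes "0 \<le> p" "p \<le> 1" "0 \<le> q" "q \<le> 1"
  shows "0 \<in> sat_F_ge (two_step_chain a p q) r a \<longleftrightarrow> p * q \<ge> r"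
proof -
  let ?M = "two_step_chain a p q"
  have "is_path_measure ?M 0 (path_measure ?M 0)"
    by (rule is_path_measure_path_measure) (simp_all add: markov_chain_two_step_chain assms)
  then have "measure (path_measure ?M 0) (cylinder ?M 0 (\<lambda>i. i) 2) =
      (\<Prod>i<2. trans ?M i (Suc i))"
    by (auto simp: is_path_measure_def numeral_2_eq_2 le_Suc_eq)
  also have "\<dots> = p * q"
    by (simp add: two_step_trans_def numeral_2_eq_2)
  finally show ?thesis
    unfolding sat_F_ge_def mem_Collect_eq reach_eq_cylinder by simp
qed

text \<open>Only the row of state 1 depends on the last parameter \<open>q\<close>, and its sums are
  0, \<open>q\<close>, \<open>1 - q\<close> or 1. Neither \<open>q\<close> nor \<open>1 - q\<close>
  meets \<open>d\<close> while \<open>q\<close> runs from \<open>u\<close> to \<open>v\<close>, so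
  they stay strictly on one side of it.\<close>

lemma two_step_trans_cmp:
  assumes "\<And>x. u \<le> x \<Longrightarrow> x \<le> v \<Longrightarrow> x \<noteq> d \<and> 1 - x \<noteq> d" and "u \<le> v" and "X \<subseteq> {0, 1, 2, 3}"
  shows "cmp_holds c (\<Sum>t\<in>X. two_step_trans p v s t) d \<longleftrightarrow>
         cmp_holds c (\<Sum>t\<in>X. two_step_trans p u s t) d"
proof (cases "s = 1")
  case True
  have fin: "finite X" using assms(3) finite_subset by blast
  have sum: "(\<Sum>t\<in>X. two_step_trans p q s t) =
      (if 2 \<in> X then q else 0) + (if 3 \<in> X then 1 - q else 0)" for q
  proof -
    have "(\<Sum>t\<in>X. two_step_trans p q s t) =
        (\<Sum>t\<in>X. (if t = 2 then q else 0) + (if t = 3 then 1 - q else 0))"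
      by (rule sum.cong) (auto simp: True two_step_trans_def)
    also have "\<dots> = (if 2 \<in> X then q else 0) + (if 3 \<in> X then 1 - q else 0)"
      using fin by (simp add: sum.distrib)
    finally show ?thesis .
  qed
  \<comment> \<open>Taking \<open>x = d\<close> and \<open>x = 1 - d\<close> shows that both points
    lie outside the interval from \<open>u\<close> to \<open>v\<close>.\<close>
  have "d < u \<or> v < d" "1 - d < u \<or> v < 1 - d"
    using assms(1)[of d] assms(1)[of "1 - d"] by force+
  then show ?thesis
    unfolding sum using assms(2) by (cases c) auto
next
  case False
  then have "two_step_trans p v s = two_step_trans p u s"
    by (auto simp: two_step_trans_def fun_eq_iff)
  then show ?thesis by simp
qed

lemma interval_avoiding_finite:
  fixes a b :: real
  assumes "finite D" "a < b"
  obtains u v where "a < u" "u < v" "v < b" "{u..v} \<inter> D = {}"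
proof -
  have "infinite ({a<..<b} - D)"
    using assms by (simp add: infinite_Ioo Diff_infinite_finite)
  then obtain v where v: "v \<in> {a<..<b} - D"
    using infinite_imp_nonempty by blast
  \<comment> \<open>No point of \<open>D\<close> lies strictly between \<open>m\<close> and
    \<open>v\<close>. Inserting \<open>a\<close> keeps the set nonempty and gives
    \<open>a \<le> m\<close>.\<close>
  define m where "m = Max (insert a {d \<in> D. d < v})"
  have m: "a \<le> m" "m < v" "\<And>d. d \<in> D \<Longrightarrow> d < v \<Longrightarrow> d \<le> m"
    using v assms(1) by (auto simp: m_def)
  obtain u where "m < u" "u < v" using dense[OF m(2)] by blast
  moreover have "{u..v} \<inter> D = {}"
  proof -
    have "d \<notin> D" if "u \<le> d" "d \<le> v" for d
      using m(3)[of d] that v \<open>m < u\<close> by (cases "d = v") auto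
    then show ?thesis by auto
  qed
  ultimately show ?thesis using that[of u v] m(1) v by auto
qed

theorem theorem4:
  fixes a :: "'a::countable"
  shows "\<not> (\<exists>g :: ('a, 'z::countable) pmutl. wf_pmutl g \<and> closed_pmutl g \<and>
           (\<forall>M :: (nat, 'a) mc. markov_chain M \<longrightarrow> sem0 M g = sat_F_ge M (1/2) a))"
proof
  assume "\<exists>g :: ('a, 'z) pmutl. wf_pmutl g \<and> closed_pmutl g \<and>
           (\<forall>M :: (nat, 'a) mc. markov_chain M \<longrightarrow> sem0 M g = sat_F_ge M (1/2) a)"
  then obtain g :: "('a, 'z) pmutl"
    where g: "\<And>M :: (nat, 'a) mc. markov_chain M \<Longrightarrow> sem0 M g = sat_F_ge M (1/2) a"
    by blast
  \<comment> \<open>The reflected thresholds are included because \<open>1 - q\<close> is a row sum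
    as well.\<close>
  have "finite (thresholds g \<union> (\<lambda>d. 1 - d) ` thresholds g)"
    by (simp add: finite_thresholds)
  then obtain u v :: real where uv: "1/2 < u" "u < v" "v < 1"
    and avoid: "{u..v} \<inter> (thresholds g \<union> (\<lambda>d. 1 - d) ` thresholds g) = {}"
    by (rule interval_avoiding_finite[where a = "1/2" and b = 1]) simp
  \<comment> \<open>This makes the target probability exactly 1/2 at \<open>v\<close>, and
    \<open>v > 1/2\<close> ensures \<open>p \<le> 1\<close>. That \<open>p\<close> may be a
    threshold is harmless, as both chains share it.\<close>
  define p where "p = 1 / (2 * v)"
  have p: "0 < p" "p \<le> 1" "p * v = 1/2"
    using uv by (simp_all add: p_def field_simps)
  have "p * u < 1/2"
    using p uv by (metis mult_strict_left_mono)
  let ?M = "\<lambda>q. two_step_chain a p q"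
  have "sem (?M v) g (\<lambda>_. {}) = sem (?M u) g (\<lambda>_. {})"
  proof (rule sem_eq_of_thresholds)
    fix s X c d
    assume "X \<subseteq> states (?M v)" and d: "d \<in> thresholds g"
    have "x \<noteq> d \<and> 1 - x \<noteq> d" if "u \<le> x" "x \<le> v" for x
    proof -
      have "x \<notin> thresholds g" "x \<notin> (\<lambda>d. 1 - d) ` thresholds g"
        using avoid that by auto
      then show ?thesis using d by (auto simp: image_iff)
    qed
    with \<open>X \<subseteq> states (?M v)\<close> uv(2)
    show "cmp_holds c (\<Sum>t\<in>X. trans (?M v) s t) d \<longleftrightarrow> cmp_holds c (\<Sum>t\<in>X. trans (?M u) s t) d"
      by (simp add: two_step_trans_cmp)
  qed simp_all
  then have "sem0 (?M v) g = sem0 (?M u) g"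
    by (simp only: sem0_def)
  then have "sat_F_ge (?M v) (1/2) a = sat_F_ge (?M u) (1/2) a"
    using g[OF markov_chain_two_step_chain] p uv by simp
  moreover have "0 \<in> sat_F_ge (?M v) (1/2) a" "0 \<notin> sat_F_ge (?M u) (1/2) a"
    using p uv \<open>p * u < 1/2\<close> by (simp_all add: two_step_chain_sat_F_ge)
  ultimately show False by simp
qed

end
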